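(* Let $A=(a_{ij})_{1\le i,j\le n}$ be an irreducible type-I staircase ASSR matrix with signature $\varepsilon=(\varepsilon_1,\dots,\varepsilon_n)$, and let $C(A)=(c_{ij})_{1\le i,j\le n}$ be its combined matrix. Then for all $1\le i,j\le n$, $a_{ij}\neq 0$ if and only if $c_{ij}\neq 0$.
   Context: The combined matrix of a nonsingular real matrix $A$ is the Hadamard (entrywise) product $C(A)=A\circ (A^{-1})^T$, i.e. $c_{ij}=\frac{1}{\det A}(-1)^{i+j}a_{ij}A_{ij}$ where $A_{ij}$ is the determinant of $A$ with row $i$ and column $j$ removed. For $\alpha,\beta\in Q_{m,n}$ (increasing sequences of $m$ integers in $\{1,\dots,n\}$), $A[\alpha|\beta]$ denotes the submatrix with rows $\alpha$ and columns $\beta$. A real matrix $A=(a_{ij})$ is type-I staircase if: (i) $a_{ii}\neq 0$ for all $i$; (ii) if $a_{ij}=0$ with $i>j$, then $a_{kl}=0$ for all $l\le j$, $k\ge i$; (iii) if $a_{ij}=0$ with $i<j$, then $a_{kl}=0$ for all $k\le i$, $l\ge j$. It is type-II staircase if: (i) $a_{i,n-i+1}\neq 0$ for all $i$; (ii) if $a_{ij}=0$ with $j>n-i+1$, then $a_{kl}=0$ for all $k\ge i$, $l\ge j$; (iii) if $a_{ij}=0$ with $j<n-i+1$, then $a_{kl}=0$ for all $k\le i$, $l\le j$. For a type-I (resp. type-II) staircase matrix, a submatrix $A[\alpha|\beta]$ is nontrivial if $a_{\alpha_i\beta_i}\neq0$ (resp. $a_{\alpha_i\beta_{m-i+1}}\neq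 0$) for all $i=1,\dots,m$. A signature is $\varepsilon=(\varepsilon_1,\dots,\varepsilon_n)$ with $\varepsilon_i\in\{\pm1\}$. $A$ is ASSR with signature $\varepsilon$ if it is type-I or type-II staircase and $\varepsilon_m\det A[\alpha|\beta]>0$ for every nontrivial submatrix $A[\alpha|\beta]$ of order $m$, $m\le n$ (such matrices are nonsingular). A square matrix $A$ is reducible if there is a permutation matrix $P$ with $PAP^T=\begin{pmatrix}B&0\\ C&D\end{pmatrix}$, $B,D$ square; otherwise irreducible. *)

theory Defs
  imports
    "Jordan_Normal_Form.Determinant"
    "Jordan_Normal_Form.Gauss_Jordan_Elimination"
    "Jordan_Normal_Form.DL_Submatrix"
begin

text \<open>
  Rows and columns are numbered from 0, as in the matrix library: the informal entry with
  indices i, j is \<open>A $$ (i - 1, j - 1)\<close>, and the antidiagonal j = n - i + 1 becomes \<open>j = n - 1 - i\<close>.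
  Signatures and orders of submatrices keep their numbering from 1.
\<close>

definition hadamard_prod :: "real mat \<Rightarrow> real mat \<Rightarrow> real mat" where
  "hadamard_prod A B = mat (dim_row A) (dim_col A) (\<lambda>(i, j). A $$ (i, j) * B $$ (i, j))"

text \<open>Meaningful for nonsingular \<open>A\<close> only: otherwise \<open>mat_inverse A = None\<close>.\<close>

definition combined_mat :: "real mat \<Rightarrow> real mat" where
  "combined_mat A = hadamard_prod A (transpose_mat (the (mat_inverse A)))"

definition increasing_seqs :: "nat \<Rightarrow> nat \<Rightarrow> nat list set" where
  "increasing_seqs m n = {\<alpha>. length \<alpha> = m \<and> sorted_wrt (<) \<alpha> \<and> set \<alpha> \<subseteq> {..<n}}"

text \<open>
  The library's \<open>submatrix\<close> takes index sets and lists them in increasing order;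
  \<open>submat_eq\<close> below confirms that the entry (i, j) is \<open>A $$ (\<alpha> ! i, \<beta> ! j)\<close>.
\<close>

definition submat :: "real mat \<Rightarrow> nat list \<Rightarrow> nat list \<Rightarrow> real mat" where
  "submat A \<alpha> \<beta> = submatrix A (set \<alpha>) (set \<beta>)"

definition type_I_staircase :: "nat \<Rightarrow> real mat \<Rightarrow> bool" where
  "type_I_staircase n A \<longleftrightarrow>
     A \<in> carrier_mat n n \<and>
     (\<forall>i<n. A $$ (i, i) \<noteq> 0) \<and>
     (\<forall>i<n. \<forall>j<n. A $$ (i, j) = 0 \<and> i > j \<longrightarrow>
        (\<forall>k<n. \<forall>l<n. l \<le> j \<and> k \<ge> i \<longrightarrow> A $$ (k, l) = 0)) \<and>
     (\<forall>i<n. \<forall>j<n. A $$ (i, j) = 0 \<and> i < j \<longrightarrow>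
        (\<forall>k<n. \<forall>l<n. k \<le> i \<and> l \<ge> j \<longrightarrow> A $$ (k, l) = 0))"

definition type_II_staircase :: "nat \<Rightarrow> real mat \<Rightarrow> bool" where
  "type_II_staircase n A \<longleftrightarrow>
     A \<in> carrier_mat n n \<and>
     (\<forall>i<n. A $$ (i, n - 1 - i) \<noteq> 0) \<and>
     (\<forall>i<n. \<forall>j<n. A $$ (i, j) = 0 \<and> j > n - 1 - i \<longrightarrow>
        (\<forall>k<n. \<forall>l<n. k \<ge> i \<and> l \<ge> j \<longrightarrow> A $$ (k, l) = 0)) \<and>
     (\<forall>i<n. \<forall>j<n. A $$ (i, j) = 0 \<and> j < n - 1 - i \<longrightarrow>
        (\<forall>k<n. \<forall>l<n. k \<le> i \<and> l \<le> j \<longrightarrow> A $$ (k, l) = 0))"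

text \<open>
  For an \<open>A\<close> of both types every entry is nonzero, so both clauses then hold for all
  \<open>\<alpha>\<close> and \<open>\<beta>\<close>.
\<close>

definition nontrivial_submat :: "nat \<Rightarrow> real mat \<Rightarrow> nat \<Rightarrow> nat list \<Rightarrow> nat list \<Rightarrow> bool" where
  "nontrivial_submat n A m \<alpha> \<beta> \<longleftrightarrow>
     (type_I_staircase n A \<and> (\<forall>i<m. A $$ (\<alpha> ! i, \<beta> ! i) \<noteq> 0)) \<or>
     (type_II_staircase n A \<and> (\<forall>i<m. A $$ (\<alpha> ! i, \<beta> ! (m - 1 - i)) \<noteq> 0))"

definition signature :: "nat \<Rightarrow> (nat \<Rightarrow> real) \<Rightarrow> bool" where
  "signature n \<epsilon> \<longleftrightarrow> (\<forall>m\<in>{1..n}. \<epsilon> m \<in> {1, -1})"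

definition ASSR :: "nat \<Rightarrow> real mat \<Rightarrow> (nat \<Rightarrow> real) \<Rightarrow> bool" where
  "ASSR n A \<epsilon> \<longleftrightarrow>
     signature n \<epsilon> \<and>
     (type_I_staircase n A \<or> type_II_staircase n A) \<and>
     (\<forall>m\<in>{1..n}. \<forall>\<alpha>\<in>increasing_seqs m n. \<forall>\<beta>\<in>increasing_seqs m n.
        nontrivial_submat n A m \<alpha> \<beta> \<longrightarrow> \<epsilon> m * det (submat A \<alpha> \<beta>) > 0)"

definition permutation_mat :: "nat \<Rightarrow> (nat \<Rightarrow> nat) \<Rightarrow> real mat" where
  "permutation_mat n p = mat n n (\<lambda>(i, j). if j = p i then 1 else 0)"

text \<open>The bounds on \<open>k\<close> say that both diagonal blocks are nonempty.\<close>

definition reducible_mat :: "nat \<Rightarrow> real mat \<Rightarrow> bool" where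
  "reducible_mat n A \<longleftrightarrow>
     (\<exists>p k B C D. p permutes {..<n} \<and> 0 < k \<and> k < n \<and>
        B \<in> carrier_mat k k \<and> C \<in> carrier_mat (n - k) k \<and> D \<in> carrier_mat (n - k) (n - k) \<and>
        permutation_mat n p * A * transpose_mat (permutation_mat n p) =
          four_block_mat B (0\<^sub>m k (n - k)) C D)"

definition irreducible_mat :: "nat \<Rightarrow> real mat \<Rightarrow> bool" where
  "irreducible_mat n A \<longleftrightarrow> A \<in> carrier_mat n n \<and> \<not> reducible_mat n A"

lemma pick_set_nth:
  assumes "sorted_wrt (<) xs" "i < length xs"
  shows "pick (set xs) i = xs ! i"
proof -
  have eq: "{a \<in> set xs. a < xs ! i} = (!) xs ` {..<i}"
  proof (intro equalityI subsetI)
    fix a assume "a \<in> {a \<in> set xs. a < xs ! i}"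
    then obtain k where k: "k < length xs" "a = xs ! k" "xs ! k < xs ! i"
      by (auto simp: in_set_conv_nth)
    have "k < i"
    proof (rule ccontr)
      assume "\<not> k < i"
      then have "i = k \<or> i < k" by linarith
      then show False
        using k sorted_wrt_nth_less[OF assms(1), of i k] by auto
    qed
    then show "a \<in> (!) xs ` {..<i}" using k by auto
  next
    fix a assume "a \<in> (!) xs ` {..<i}"
    then show "a \<in> {a \<in> set xs. a < xs ! i}"
      using assms sorted_wrt_nth_less[OF assms(1), of _ i] by auto
  qed
  have "inj_on ((!) xs) {..<i}"
    using assms strict_sorted_iff[of xs] by (auto simp: inj_on_def nth_eq_iff_index_eq)
  then have "card {a \<in> set xs. a < xs ! i} = i"
    unfolding eq by (simp add: card_image)
  then show ?thesis
    using pick_card_in_set[of "xs ! i" "set xs"] assms by auto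
qed

lemma submat_eq:
  assumes "A \<in> carrier_mat n n" "\<alpha> \<in> increasing_seqs m n" "\<beta> \<in> increasing_seqs m n"
  shows "submat A \<alpha> \<beta> = mat m m (\<lambda>(i, j). A $$ (\<alpha> ! i, \<beta> ! j))"
proof -
  have *: "{i. i < n \<and> i \<in> set xs} = set xs" "card (set xs) = m"
    if "xs \<in> increasing_seqs m n" for xs
    using that strict_sorted_iff[of xs]
    by (auto simp: increasing_seqs_def distinct_card)
  show ?thesis
    using assms *[OF assms(2)] *[OF assms(3)]
    by (intro eq_matI)
      (auto simp: submat_def submatrix_def pick_set_nth increasing_seqs_def)
qed

lemma combined_mat_index:
  assumes A: "A \<in> carrier_mat n n" and d: "det A \<noteq> 0" and ij: "i < n" "j < n"
  shows "combined_mat A $$ (i, j) =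
    1 / det A * (-1) ^ (i + j) * A $$ (i, j) * det (mat_delete A i j)"
proof -
  have unit: "A \<in> Units (ring_mat TYPE(real) n ())"
    using A d by (rule det_non_zero_imp_unit)
  then obtain B where B: "mat_inverse A = Some B"
    using mat_inverse(1)[OF A, of "()"] by (cases "mat_inverse A") auto
  have BA: "A * B = 1\<^sub>m n" "B * A = 1\<^sub>m n" "B \<in> carrier_mat n n"
    using mat_inverse(2)[OF A B] by auto
  note adj = adj_mat[OF A]
  have "adj_mat A = B * A * adj_mat A"
    using BA adj(1) by simp
  also have "\<dots> = B * (A * adj_mat A)"
    using assoc_mult_mat[OF BA(3) A adj(1)] .
  also have "\<dots> = det A \<cdot>\<^sub>m B"
    unfolding adj(2) using BA(3) mult_smult_distrib[OF BA(3) one_carrier_mat] by simp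
  finally have "adj_mat A $$ (j, i) = (det A \<cdot>\<^sub>m B) $$ (j, i)" by simp
  then have "cofactor A i j = det A * B $$ (j, i)"
    using ij A BA(3) by (simp add: adj_mat_def)
  then have "B $$ (j, i) = 1 / det A * cofactor A i j"
    using d by simp
  then show ?thesis
    using ij A BA(3) B by (simp add: combined_mat_def hadamard_prod_def cofactor_def)
qed

end

theory Submission
  imports Defs
begin

text \<open>
  Irreducibility forces every entry next to the diagonal to be nonzero, because by the staircase
  shape a zero there spreads to a whole off-diagonal block. The diagonal of the submatrix obtained
  by deleting row i and column j consists of entries on or next to the diagonal of \<open>A\<close>,
  so this submatrix is nontrivial and its determinant is nonzero.
\<close>

lemma permutation_mat_conjugate:
  assumes A: "A \<in> carrier_mat n n" and p: "p permutes {..<n}"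
  shows "permutation_mat n p * A * transpose_mat (permutation_mat n p) =
    mat n n (\<lambda>(i, j). A $$ (p i, p j))" (is "?P * A * ?Q = _")
proof -
  have P: "?P \<in> carrier_mat n n" by (simp add: permutation_mat_def)
  have pn: "p i < n" if "i < n" for i
    using permutes_in_image[OF p, of i] that by simp
  have PA: "?P * A = mat n n (\<lambda>(i, j). A $$ (p i, j))"
  proof (rule eq_matI)
    fix i j assume "i < dim_row (mat n n (\<lambda>(i, j). A $$ (p i, j)))"
      "j < dim_col (mat n n (\<lambda>(i, j). A $$ (p i, j)))"
    then have ij: "i < n" "j < n" by auto
    have "(?P * A) $$ (i, j) = (\<Sum>k = 0..<n. (if k = p i then 1 else 0) * A $$ (k, j))"
      using ij A by (simp add: scalar_prod_def permutation_mat_def)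
    also have "\<dots> = (\<Sum>k = 0..<n. if k = p i then A $$ (k, j) else 0)"
      by (rule sum.cong) auto
    also have "\<dots> = A $$ (p i, j)" using pn[OF ij(1)] by simp
    finally show "(?P * A) $$ (i, j) = mat n n (\<lambda>(i, j). A $$ (p i, j)) $$ (i, j)"
      using ij by simp
  qed (use A P in auto)
  show ?thesis unfolding PA
  proof (rule eq_matI)
    fix i j assume "i < dim_row (mat n n (\<lambda>(i, j). A $$ (p i, p j)))"
      "j < dim_col (mat n n (\<lambda>(i, j). A $$ (p i, p j)))"
    then have ij: "i < n" "j < n" by auto
    have "(mat n n (\<lambda>(i, j). A $$ (p i, j)) * ?Q) $$ (i, j) =
        (\<Sum>k = 0..<n. A $$ (p i, k) * (if k = p j then 1 else 0))"
      using ij by (simp add: scalar_prod_def permutation_mat_def)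
    also have "\<dots> = (\<Sum>k = 0..<n. if k = p j then A $$ (p i, k) else 0)"
      by (rule sum.cong) auto
    also have "\<dots> = A $$ (p i, p j)" using pn[OF ij(2)] by simp
    finally show "(mat n n (\<lambda>(i, j). A $$ (p i, j)) * ?Q) $$ (i, j) =
        mat n n (\<lambda>(i, j). A $$ (p i, p j)) $$ (i, j)"
      using ij by simp
  qed (use P in auto)
qed

text \<open>Conjugation by \<open>permutation_mat n p\<close> only relabels rows and columns, so
  reducibility comes down to finding an order of the indices that puts a zero block in the upper
  right corner; the other blocks are read off.\<close>

lemma reducible_mat_if_zero_block:
  assumes A: "A \<in> carrier_mat n n" and p: "p permutes {..<n}" and k: "0 < k" "k < n"
    and zero: "\<And>i j. i < k \<Longrightarrow> k \<le> j \<Longrightarrow> j < n \<Longrightarrow> A $$ (p i, p j) = 0"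
  shows "reducible_mat n A"
proof -
  let ?B = "mat k k (\<lambda>(i, j). A $$ (p i, p j))"
  let ?C = "mat (n - k) k (\<lambda>(i, j). A $$ (p (i + k), p j))"
  let ?D = "mat (n - k) (n - k) (\<lambda>(i, j). A $$ (p (i + k), p (j + k)))"
  have "permutation_mat n p * A * transpose_mat (permutation_mat n p) =
      four_block_mat ?B (0\<^sub>m k (n - k)) ?C ?D"
    unfolding permutation_mat_conjugate[OF A p]
    by (rule eq_matI) (use k zero in auto)
  then show ?thesis
    unfolding reducible_mat_def using p k
    by (intro exI[of _ p] exI[of _ k] exI[of _ ?B] exI[of _ ?C] exI[of _ ?D]) auto
qed

lemma type_I_staircase_carrier: "type_I_staircase n A \<Longrightarrow> A \<in> carrier_mat n n"
  unfolding type_I_staircase_def by (rule conjunct1)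

lemma type_I_staircase_diagonal: "type_I_staircase n A \<Longrightarrow> \<forall>i<n. A $$ (i, i) \<noteq> 0"
  unfolding type_I_staircase_def by (elim conjE)

text \<open>A zero here would spread up and to the right over rows 0 to k and columns from
  \<open>Suc k\<close> on. That is already the corner required for reducibility, so the identity
  permutation serves.\<close>

lemma irreducible_type_I_superdiagonal_nonzero:
  assumes irr: "irreducible_mat n A" and stair: "type_I_staircase n A" and k: "Suc k < n"
  shows "A $$ (k, Suc k) \<noteq> 0"
proof
  assume 0: "A $$ (k, Suc k) = 0"
  have "A $$ (i, j) = 0" if "i < Suc k" "Suc k \<le> j" "j < n" for i j
  proof -
    have "k < n" "i < n" "i \<le> k" using that k by auto
    then show ?thesis
      using stair 0 k that unfolding type_I_staircase_def by (meson lessI)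
  qed
  then have "reducible_mat n A"
    using irr k
    by (intro reducible_mat_if_zero_block[of A n id "Suc k"])
      (auto simp: irreducible_mat_def)
  then show False using irr by (simp add: irreducible_mat_def)
qed

text \<open>Here a zero would spread to the lower left corner; reversing the order of the indices
  carries that block to the upper right.\<close>

lemma irreducible_type_I_subdiagonal_nonzero:
  assumes irr: "irreducible_mat n A" and stair: "type_I_staircase n A" and k: "Suc k < n"
  shows "A $$ (Suc k, k) \<noteq> 0"
proof
  assume 0: "A $$ (Suc k, k) = 0"
  have z: "A $$ (i, j) = 0" if "j \<le> k" "Suc k \<le> i" "i < n" for i j
  proof -
    have "k < n" "j < n" using that k by auto
    then show ?thesis
      using stair 0 k that unfolding type_I_staircase_def by (meson lessI)
  qed
  \<comment> \<open>The reversal is its own inverse, hence its own bijectivity witness;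
    \<open>permutes\<close> demands that it fix everything outside the range.\<close>
  define p where "p = (\<lambda>i. if i < n then n - 1 - i else i)"
  have "bij_betw p {..<n} {..<n}"
    by (rule bij_betw_byWitness[where f' = p]) (auto simp: p_def)
  then have "p permutes {..<n}"
    by (rule bij_imp_permutes) (auto simp: p_def)
  then have "reducible_mat n A"
    using irr k
    \<comment> \<open>After the reversal the rows \<open>Suc k\<close> to \<open>n - 1\<close> come
      first, and there are \<open>n - 1 - k\<close> of them.\<close>
    by (intro reducible_mat_if_zero_block[of A n p "n - 1 - k"])
      (auto simp: irreducible_mat_def p_def intro!: z)
  then show False using irr by (simp add: irreducible_mat_def)
qed

lemma type_I_ASSR_det_nonzero:
  assumes stair: "type_I_staircase n A" and assr: "ASSR n A \<epsilon>"
    and \<alpha>: "\<alpha> \<in> increasing_seqs m n" and \<beta>: "\<beta> \<in> increasing_seqs m n" and m: "m \<le> n"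
    and diag: "\<And>k. k < m \<Longrightarrow> A $$ (\<alpha> ! k, \<beta> ! k) \<noteq> 0"
  shows "det (mat m m (\<lambda>(k, l). A $$ (\<alpha> ! k, \<beta> ! l))) \<noteq> 0"
\<comment> \<open>\<open>ASSR\<close> speaks of orders from 1 on only. Order 0, where the
  determinant is 1, arises on deleting a row and a column of a matrix of order 1.\<close>
proof (cases "m = 0")
  case True
  then show ?thesis by simp
next
  case False
  have "nontrivial_submat n A m \<alpha> \<beta>"
    using stair diag by (simp add: nontrivial_submat_def)
  then have "\<epsilon> m * det (submat A \<alpha> \<beta>) > 0"
    using assr \<alpha> \<beta> m False unfolding ASSR_def by auto
  then show ?thesis
    by (auto simp: submat_eq[OF type_I_staircase_carrier[OF stair] \<alpha> \<beta>])
qed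

text \<open>The matrix is a nontrivial submatrix of itself, since its diagonal has no zeros.\<close>

lemma type_I_ASSR_nonsingular:
  assumes stair: "type_I_staircase n A" and assr: "ASSR n A \<epsilon>"
  shows "det A \<noteq> 0"
proof -
  note A = type_I_staircase_carrier[OF stair] and diag = type_I_staircase_diagonal[OF stair]
  have "det (mat n n (\<lambda>(k, l). A $$ ([0..<n] ! k, [0..<n] ! l))) \<noteq> 0"
    by (rule type_I_ASSR_det_nonzero[OF stair assr])
      (use diag in \<open>auto simp: increasing_seqs_def\<close>)
  also have "mat n n (\<lambda>(k, l). A $$ ([0..<n] ! k, [0..<n] ! l)) = A"
    by (rule eq_matI) (use A in auto)
  finally show ?thesis .
qed

text \<open>For i < n this sequence lists the indices other than i, that is, the rows or columns
  that survive a deletion.\<close>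

lemma increasing_seqs_insert_index:
  "map (insert_index i) [0..<n - 1] \<in> increasing_seqs (n - 1) n"
  by (auto simp: increasing_seqs_def sorted_wrt_iff_nth_less insert_index_def)

lemma irreducible_type_I_ASSR_mat_delete_nonsingular:
  assumes irr: "irreducible_mat n A" and stair: "type_I_staircase n A" and assr: "ASSR n A \<epsilon>"
  shows "det (mat_delete A i j) \<noteq> 0"
proof -
  let ?s = "\<lambda>i. map (insert_index i) [0..<n - 1]"
  note A = type_I_staircase_carrier[OF stair]
  \<comment> \<open>Each index is k or \<open>Suc k\<close>, which leaves two diagonal entries, one
    superdiagonal and one subdiagonal entry.\<close>
  have "A $$ (insert_index i k, insert_index j k) \<noteq> 0" if "k < n - 1" for k
  proof -
    have "Suc k < n" "k < n" using that by auto
    then show ?thesis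
      using type_I_staircase_diagonal[OF stair]
        irreducible_type_I_superdiagonal_nonzero[OF irr stair, of k]
        irreducible_type_I_subdiagonal_nonzero[OF irr stair, of k]
      by (simp add: insert_index_def)
  qed
  then have "det (mat (n - 1) (n - 1) (\<lambda>(k, l). A $$ (?s i ! k, ?s j ! l))) \<noteq> 0"
    by (intro type_I_ASSR_det_nonzero[OF stair assr] increasing_seqs_insert_index) auto
  also have "mat (n - 1) (n - 1) (\<lambda>(k, l). A $$ (?s i ! k, ?s j ! l)) = mat_delete A i j"
    by (rule eq_matI) (use A in \<open>auto simp: mat_delete_def insert_index_def\<close>)
  finally show ?thesis .
qed

theorem theorem2:
  fixes n :: nat and A :: "real mat" and \<epsilon> :: "nat \<Rightarrow> real"
  assumes "A \<in> carrier_mat n n"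
    and "irreducible_mat n A"
    and "type_I_staircase n A"
    and "ASSR n A \<epsilon>"
  shows "\<forall>i<n. \<forall>j<n. A $$ (i, j) \<noteq> 0 \<longleftrightarrow> combined_mat A $$ (i, j) \<noteq> 0"
  \<comment> \<open>By the cofactor formula the two entries differ by a factor made of a sign, the
    minor and the inverse of \<open>det A\<close>, all nonzero.\<close>
  using type_I_ASSR_nonsingular[OF assms(3,4)]
    irreducible_type_I_ASSR_mat_delete_nonsingular[OF assms(2-4)]
  by (simp add: combined_mat_index[OF assms(1)])

end
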